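(* Let $r\ge 2$ be a fixed integer and let $\mathbf{x}=(2,\underbrace{1,\dots,1}_{r-2})$. Then \[ m(\mathbf{x},n)=\left(\frac{1}{r-1}+o(1)\right)n, \] where $o(1)$ denotes a quantity tending to $0$ as $n\to\infty$.
   Context: $[n]=\{1,\dots,n\}$ and $[n]^{(r)}$ is the family of all $r$-element subsets of $[n]$. A Hamilton cycle in $K_n$ (on vertex set $[n]$) is regarded as a cyclic ordering $c_1,c_2,\dots,c_n$ of $[n]$, with indices taken modulo $n$. For $\mathbf{x}=(x_1,\dots,x_k)$ a vector of positive integers with $\sum_i x_i=r$ and a family $\mathcal{F}\subseteq[n]^{(r)}$, a Hamilton cycle $c_1,\dots,c_n$ is called $\mathbf{x}$-acceptable for (or with respect to) $\mathcal{F}$ if there do not exist $t_1,\dots,t_k$ with $\bigcup_{i=1}^k\{c_{t_i+1},c_{t_i+2},\dots,c_{t_i+x_i}\}\in\mathcal{F}$. Then $m(\mathbf{x},n)$ (for $n\ge r$) denotes the minimum of $|\mathcal{F}|$ over all families $\mathcal{F}\subseteq[n]^{(r)}$ such that $K_n$ does not contain an $\mathbf{x}$-acceptable Hamilton cycle with respect to $\mathcal{F}$. *)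

theory Defs
  imports Complex_Main
begin

definition subsets_of_size :: "nat \<Rightarrow> nat \<Rightarrow> nat set set" where
  "subsets_of_size n r = {A. A \<subseteq> {1..n} \<and> card A = r}"

text \<open>
  A Hamilton cycle of the complete graph on \<open>{1..n}\<close> is a cyclic ordering \<open>c 1, \<dots>, c n\<close>.
  Indices modulo \<open>n\<close> are rendered by an \<open>n\<close>-periodic function, so that natural
  number indices cover all residues and an interval may wrap around.
\<close>

definition hamilton_cycle :: "nat \<Rightarrow> (nat \<Rightarrow> nat) \<Rightarrow> bool" where
  "hamilton_cycle n c \<longleftrightarrow> bij_betw c {1..n} {1..n} \<and> (\<forall>i. c (i + n) = c i)"

text \<open>
  No disjointness of the intervals is imposed: when \<open>\<F>\<close> consists of sets of
  size \<open>sum_list x\<close>, membership of the union in \<open>\<F>\<close> forces it.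
\<close>

definition acceptable :: "nat list \<Rightarrow> nat set set \<Rightarrow> (nat \<Rightarrow> nat) \<Rightarrow> bool" where
  "acceptable x \<F> c \<longleftrightarrow>
     \<not> (\<exists>t :: nat \<Rightarrow> nat. (\<Union>i<length x. c ` {t i + 1..t i + x ! i}) \<in> \<F>)"

text \<open>
  For \<open>n \<ge> sum_list x\<close> the minimum is over a nonempty set of numbers,
  as the family of all subsets of that size admits no acceptable cycle;
  for smaller \<open>n\<close> the value is unspecified.
\<close>

definition min_family_size :: "nat list \<Rightarrow> nat \<Rightarrow> nat" where
  "min_family_size x n = (LEAST s. \<exists>\<F>. \<F> \<subseteq> subsets_of_size n (sum_list x) \<and> card \<F> = s \<and>
     \<not> (\<exists>c. hamilton_cycle n c \<and> acceptable x \<F> c))"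

end

theory Submission imports Defs
begin

text \<open>
  For \<open>x = (2, 1, \<dots>, 1)\<close> a Hamilton cycle is acceptable iff no member of \<open>\<F>\<close> contains two
  cyclically consecutive vertices, that is, iff it is a Hamilton cycle of the graph \<open>E\<close> in which
  two vertices are adjacent when no member of \<open>\<F>\<close> contains both. So the task is to destroy
  all Hamilton cycles of \<open>K\<^sub>n\<close> by deleting as few cliques of order \<open>r\<close> as possible.

  Upper bound (\<open>min_family_size_upper\<close>): about \<open>n / (r - 1)\<close> cliques through a single vertex
  isolate that vertex.

  Lower bound (\<open>ex_acceptable_cycle\<close>): suppose that \<open>(r - 1) |\<F>| + 4 r + 1 < n\<close>
  and \<open>n \<ge> 8 r\<close>. If \<open>d x\<close> members of \<open>\<F>\<close> contain \<open>x\<close>, then \<open>x\<close> has degree at least \<open>n - 1 - (r - 1) d x\<close> in \<open>E\<close>. Since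
  \<open>d x \<le> |\<F>|\<close>, every degree exceeds \<open>4 r\<close>. A vertex of degree below \<open>n / 2\<close> has
  \<open>(r - 1) d x \<ge> n / 4\<close>, and the numbers \<open>d x\<close> add up to \<open>r |\<F>| \<le> r n / (r - 1)\<close>, so there are at most
  \<open>4 r\<close> such vertices. A graph in which the number of vertices of degree below \<open>n / 2\<close> is smaller
  than every degree, and at most \<open>n / 2\<close>, is Hamiltonian (\<open>hamiltonian_few_small_degrees\<close>), by
  the closure argument of Bondy and Chvatal: joining two non-adjacent vertices whose degrees add up
  to at least \<open>n\<close> does not affect Hamiltonicity (\<open>hamiltonian_add_edge\<close>), and repeating this leads
  to the complete graph.

  Both bounds differ from \<open>n / (r - 1)\<close> by a quantity bounded in terms of \<open>r\<close>.
\<close>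

section \<open>Hamiltonian graphs and the Bondy-Chvatal closure\<close>

text \<open>
  The graph with vertex set \<open>V\<close> and adjacency relation \<open>E\<close> has a spanning cycle, listed from an
  arbitrary starting point. On two vertices a single edge of a symmetric relation counts as such a
  cycle.
\<close>

definition hamiltonian :: "'a set \<Rightarrow> ('a \<Rightarrow> 'a \<Rightarrow> bool) \<Rightarrow> bool" where
  "hamiltonian V E \<longleftrightarrow>
     (\<exists>xs. distinct xs \<and> set xs = V \<and> successively E xs \<and> E (last xs) (hd xs))"

text \<open>The number of neighbours of \<open>x\<close> in \<open>V\<close>.\<close>

definition degree :: "'a set \<Rightarrow> ('a \<Rightarrow> 'a \<Rightarrow> bool) \<Rightarrow> 'a \<Rightarrow> nat" where
  "degree V E x = card {y \<in> V. E x y}"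

text \<open>The graph \<open>E\<close> with the undirected edge \<open>u v\<close> added.\<close>

definition add_edge :: "('a \<Rightarrow> 'a \<Rightarrow> bool) \<Rightarrow> 'a \<Rightarrow> 'a \<Rightarrow> 'a \<Rightarrow> 'a \<Rightarrow> bool" where
  "add_edge E u v x y \<longleftrightarrow> E x y \<or> (x = u \<and> y = v) \<or> (x = v \<and> y = u)"

lemma degree_mono:
  assumes "finite V" "\<And>y. E x y \<Longrightarrow> E' x y"
  shows "degree V E x \<le> degree V E' x"
  unfolding degree_def using assms by (intro card_mono) auto

text \<open>
  Crossing argument: by the pigeonhole principle some edge \<open>p\<^sub>i p\<^sub>i\<^sub>+\<^sub>1\<close> of the path has its first
  vertex adjacent to the end of the path and its second vertex adjacent to the beginning; reversing
  the part after \<open>p\<^sub>i\<close> closes the path up.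
\<close>

lemma hamiltonian_path_degree_sum:
  assumes sym: "\<And>x y. E x y \<Longrightarrow> E y x" and irr: "\<And>x. \<not> E x x"
    and p: "distinct p" "p \<noteq> []" "set p = V" "successively E p"
    and deg: "degree V E (hd p) + degree V E (last p) \<ge> card V"
  shows "hamiltonian V E"
proof -
  let ?n = "length p"
  define S where "S = {i. Suc i < ?n \<and> E (hd p) (p ! Suc i)}"
  define T where "T = {i. Suc i < ?n \<and> E (last p) (p ! i)}"
  have n: "card V = ?n" using p distinct_card by fastforce
  have n0: "?n > 0" using p by simp
  have finS: "finite S" and finT: "finite T"
    unfolding S_def T_def by (auto intro: finite_subset[of _ "{..<?n}"])
  have "{y \<in> V. E (hd p) y} \<subseteq> (\<lambda>i. p ! Suc i) ` S"
  proof
    fix y assume y: "y \<in> {y \<in> V. E (hd p) y}"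
    then obtain j where j: "j < ?n" "y = p ! j" using p by (auto simp: in_set_conv_nth)
    have "j \<noteq> 0" using y j irr p(2) by (metis (mono_tags) hd_conv_nth mem_Collect_eq)
    then obtain i where "j = Suc i" by (cases j) auto
    then show "y \<in> (\<lambda>i. p ! Suc i) ` S" using y j by (auto simp: S_def)
  qed
  then have dS: "degree V E (hd p) \<le> card S"
    unfolding degree_def using finS surj_card_le by metis
  have "{y \<in> V. E (last p) y} \<subseteq> (\<lambda>i. p ! i) ` T"
  proof
    fix y assume y: "y \<in> {y \<in> V. E (last p) y}"
    then obtain j where j: "j < ?n" "y = p ! j" using p by (auto simp: in_set_conv_nth)
    have "j \<noteq> ?n - 1" using y j irr p(2) by (metis (mono_tags) last_conv_nth mem_Collect_eq)
    then have "Suc j < ?n" using j by auto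
    then show "y \<in> (\<lambda>i. p ! i) ` T" using y j by (auto simp: T_def)
  qed
  then have dT: "degree V E (last p) \<le> card T"
    unfolding degree_def using finT surj_card_le by metis
  have "card (S \<union> T) \<le> card {..<?n - 1}"
    by (rule card_mono) (auto simp: S_def T_def)
  then have "card (S \<union> T) < card S + card T" using dS dT deg n n0
    unfolding card_lessThan by linarith
  then have "S \<inter> T \<noteq> {}" using finS finT card_Un_disjoint by fastforce
  then obtain i where i: "Suc i < ?n" "E (hd p) (p ! Suc i)" "E (last p) (p ! i)"
    by (auto simp: S_def T_def)
  define a where "a = take (Suc i) p"
  define b where "b = drop (Suc i) p"
  have ab: "p = a @ b" "a \<noteq> []" "b \<noteq> []" using i p(2) by (auto simp: a_def b_def)
  have la: "last a = p ! i" using i by (simp add: a_def take_Suc_conv_app_nth)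
  have hb: "hd b = p ! Suc i" using i by (simp add: b_def hd_drop_conv_nth)
  have sa: "successively E a" "successively E b"
    using p(4) ab by (auto simp: successively_append_iff)
  have sb: "successively E (rev b)"
    unfolding successively_rev
    by (rule successively_mono[OF sa(2)]) (auto intro: sym)
  have "successively E (a @ rev b)"
    using sa(1) sb i(3) ab la sym by (auto simp: successively_append_iff hd_rev)
  moreover have "E (last (a @ rev b)) (hd (a @ rev b))"
    using ab hb i(2) sym by (simp add: last_rev)
  moreover have "distinct (a @ rev b)" "set (a @ rev b) = V" using p ab by auto
  ultimately show ?thesis unfolding hamiltonian_def by blast
qed

lemma hamiltonian_add_edge:
  assumes sym: "\<And>x y. E x y \<Longrightarrow> E y x" and irr: "\<And>x. \<not> E x x"
    and n3: "card V \<ge> 3"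
    and deg: "degree V E u + degree V E v \<ge> card V"
    and ham: "hamiltonian V (add_edge E u v)"
  shows "hamiltonian V E"
proof -
  let ?E' = "add_edge E u v"
  \<comment> \<open>If the cycle uses the new edge, the rest of the cycle is a path between its ends.\<close>
  have path: "hamiltonian V E"
    if q: "distinct q" "set q = V" "successively ?E' q"
      and ends: "(hd q = u \<and> last q = v) \<or> (hd q = v \<and> last q = u)" for q
  proof -
    have len: "length q \<ge> 3" using q n3 distinct_card by metis
    then have ne: "q \<noteq> []" by auto
    have h: "hd q = q ! 0" "last q = q ! (length q - 1)"
      using ne by (simp_all add: hd_conv_nth last_conv_nth)
    have "successively E q"
      unfolding successively_conv_nth
    proof (intro allI impI)
      fix i assume i: "Suc i < length q"
      then have e: "?E' (q ! i) (q ! Suc i)" using q(3) by (auto simp: successively_conv_nth)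
      have idx: "q ! j = q ! k \<longleftrightarrow> j = k" if "j < length q" "k < length q" for j k
        using q(1) that by (rule nth_eq_iff_index_eq)
      have "q ! Suc i \<noteq> q ! 0" using idx[of "Suc i" 0] i ne by simp
      moreover have "\<not> (q ! i = q ! 0 \<and> q ! Suc i = q ! (length q - 1))"
        using idx[of i 0] idx[of "Suc i" "length q - 1"] i len by linarith
      ultimately show "E (q ! i) (q ! Suc i)"
        using e ends unfolding h add_edge_def by metis
    qed
    moreover have "degree V E (hd q) + degree V E (last q) \<ge> card V"
      using ends deg by (metis add.commute)
    ultimately show ?thesis
      using hamiltonian_path_degree_sum[where E = E, OF sym irr q(1) ne q(2)] by blast
  qed
  obtain xs where xs: "distinct xs" "set xs = V" "successively ?E' xs" "?E' (last xs) (hd xs)"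
    using ham by (auto simp: hamiltonian_def)
  show ?thesis
  proof (cases "successively E xs")
    case True
    show ?thesis
    proof (cases "E (last xs) (hd xs)")
      case True
      then show ?thesis using \<open>successively E xs\<close> xs by (auto simp: hamiltonian_def)
    next
      case False
      then show ?thesis using xs path[of xs] by (auto simp: add_edge_def)
    qed
  next
    case False
    then obtain i where i: "Suc i < length xs" "\<not> E (xs ! i) (xs ! Suc i)"
      by (auto simp: successively_conv_nth)
    then have uv: "(xs ! i = u \<and> xs ! Suc i = v) \<or> (xs ! i = v \<and> xs ! Suc i = u)"
      using xs(3) by (auto simp: successively_conv_nth add_edge_def)
    define a where "a = take (Suc i) xs"
    define b where "b = drop (Suc i) xs"
    have ab: "xs = a @ b" "a \<noteq> []" "b \<noteq> []" using i by (auto simp: a_def b_def)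
    have la: "last a = xs ! i" using i by (simp add: a_def take_Suc_conv_app_nth)
    have hb: "hd b = xs ! Suc i" using i by (simp add: b_def hd_drop_conv_nth)
    have "successively ?E' (b @ a)"
      using xs(3,4) ab by (auto simp: successively_append_iff)
    then show ?thesis
      using path[of "b @ a"] xs ab la hb uv by auto
  qed
qed

lemma hamiltonian_complete:
  assumes "card V \<ge> 2" and "\<And>x y. x \<in> V \<Longrightarrow> y \<in> V \<Longrightarrow> x \<noteq> y \<Longrightarrow> E x y"
  shows "hamiltonian V E"
proof -
  have "finite V" using assms(1) card.infinite by fastforce
  then obtain xs where xs: "set xs = V" "distinct xs" using finite_distinct_list by blast
  have len: "length xs \<ge> 2" using xs assms(1) distinct_card by metis
  have ne: "xs \<noteq> []" using len by auto
  have "successively E xs"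
    using xs assms(2) by (auto simp: successively_conv_nth nth_eq_iff_index_eq)
  moreover have "last xs \<noteq> hd xs"
    using len ne xs by (simp add: hd_conv_nth last_conv_nth nth_eq_iff_index_eq)
  then have "E (last xs) (hd xs)" using ne xs assms(2) by auto
  ultimately show ?thesis using xs by (auto simp: hamiltonian_def)
qed

text \<open>
  When no further edge can be added, the graph is complete: the vertices outside \<open>B\<close> are pairwise
  adjacent, hence joined to all of \<open>B\<close>, and then the vertices of \<open>B\<close> have degree at least
  \<open>n - |B| \<ge> n / 2\<close> as well.
\<close>

lemma hamiltonian_few_small_degrees:
  assumes fin: "finite V" and n3: "card V \<ge> 3"
    and B: "B \<subseteq> V" "2 * card B \<le> card V"
    and sym: "\<And>x y. E x y \<Longrightarrow> E y x" and irr: "\<And>x. \<not> E x x"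
    and large: "\<And>x. x \<in> V - B \<Longrightarrow> card V \<le> 2 * degree V E x"
    and small: "\<And>x. x \<in> B \<Longrightarrow> card B < degree V E x"
  shows "hamiltonian V E"
  using sym irr large small
proof (induction "card {(x, y). x \<in> V \<and> y \<in> V \<and> \<not> E x y}" arbitrary: E rule: less_induct)
  case less
  note sym = less.prems(1) and irr = less.prems(2)
    and large = less.prems(3) and small = less.prems(4)
  show ?case
  proof (cases "\<exists>u\<in>V. \<exists>v\<in>V. u \<noteq> v \<and> \<not> E u v \<and> degree V E u + degree V E v \<ge> card V")
    case True
    then obtain u v where uv: "u \<in> V" "v \<in> V" "u \<noteq> v" "\<not> E u v"
      "degree V E u + degree V E v \<ge> card V" by blast
    let ?E' = "add_edge E u v"
    have degE': "degree V E x \<le> degree V ?E' x" for x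
      by (rule degree_mono[OF fin]) (simp add: add_edge_def)
    have "hamiltonian V ?E'"
    proof (rule less.hyps)
      show "card {(x, y). x \<in> V \<and> y \<in> V \<and> \<not> ?E' x y}
          < card {(x, y). x \<in> V \<and> y \<in> V \<and> \<not> E x y}"
      proof (rule psubset_card_mono)
        show "finite {(x, y). x \<in> V \<and> y \<in> V \<and> \<not> E x y}"
          by (rule finite_subset[of _ "V \<times> V"]) (use fin in auto)
        have "(u, v) \<in> {(x, y). x \<in> V \<and> y \<in> V \<and> \<not> E x y}"
          "(u, v) \<notin> {(x, y). x \<in> V \<and> y \<in> V \<and> \<not> ?E' x y}"
          using uv by (auto simp: add_edge_def)
        then show "{(x, y). x \<in> V \<and> y \<in> V \<and> \<not> ?E' x y}
            \<subset> {(x, y). x \<in> V \<and> y \<in> V \<and> \<not> E x y}"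
          by (auto simp: add_edge_def)
      qed
      show "?E' x y \<Longrightarrow> ?E' y x" for x y using sym by (auto simp: add_edge_def)
      show "\<not> ?E' x x" for x using irr uv by (auto simp: add_edge_def)
      show "x \<in> V - B \<Longrightarrow> card V \<le> 2 * degree V ?E' x" for x
        using large[of x] degE'[of x] by linarith
      show "x \<in> B \<Longrightarrow> card B < degree V ?E' x" for x
        using small[of x] degE'[of x] by linarith
    qed
    then show ?thesis using hamiltonian_add_edge[where E = E, OF sym irr n3 uv(5)] by blast
  next
    case False
    then have closed: "E u v"
      if "u \<in> V" "v \<in> V" "u \<noteq> v" "degree V E u + degree V E v \<ge> card V" for u v
      using that by blast
    have finB: "finite B" using B fin finite_subset by blast
    have cVB: "card (V - B) = card V - card B" using B finB card_Diff_subset by blast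
    have VV: "E u v" if "u \<in> V - B" "v \<in> V - B" "u \<noteq> v" for u v
      using that large[of u] large[of v] closed[of u v] by auto
    have BV: "E u v" if "u \<in> B" "v \<in> V - B" for u v
    proof -
      have "card (V - B - {v}) \<le> degree V E v"
        unfolding degree_def using fin VV that by (intro card_mono) auto
      moreover have "card (V - B - {v}) = card V - card B - 1"
        using cVB that fin by (simp add: card_Diff_singleton)
      ultimately have "degree V E u + degree V E v \<ge> card V"
        using small[OF that(1)] by linarith
      then show ?thesis using closed[of u v] that B by blast
    qed
    have degB: "card V \<le> 2 * degree V E u" if "u \<in> B" for u
    proof -
      have "card (V - B) \<le> degree V E u"
        unfolding degree_def using fin BV that by (intro card_mono) auto
      then show ?thesis using cVB B by linarith
    qed
    have "E u v" if "u \<in> V" "v \<in> V" "u \<noteq> v" for u v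
    proof -
      have "card V \<le> 2 * degree V E x" if "x \<in> V" for x
        using large[of x] degB[of x] that by blast
      from this[OF that(1)] this[OF that(2)] show ?thesis
        by (intro closed that) linarith
    qed
    then show ?thesis using hamiltonian_complete[of V E] n3 by auto
  qed
qed

section \<open>Acceptable cycles\<close>

lemma acceptable_if_no_consecutive:
  assumes "\<And>i A. A \<in> \<F> \<Longrightarrow> c i \<in> A \<Longrightarrow> c (Suc i) \<notin> A"
  shows "acceptable (2 # x) \<F> c"
  unfolding acceptable_def
proof
  assume "\<exists>t. (\<Union>i<length (2 # x). c ` {t i + 1..t i + (2 # x) ! i}) \<in> \<F>"
  then obtain t where t: "(\<Union>i<length (2 # x). c ` {t i + 1..t i + (2 # x) ! i}) \<in> \<F>" by blast
  have "c (Suc (t 0)) \<in> (\<Union>i<length (2 # x). c ` {t i + 1..t i + (2 # x) ! i})"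
    "c (Suc (Suc (t 0))) \<in> (\<Union>i<length (2 # x). c ` {t i + 1..t i + (2 # x) ! i})"
    by (rule UN_I[of 0]; force)+
  then show False using assms t by blast
qed

lemma not_acceptable_if_consecutive:
  assumes c: "hamilton_cycle n c" and A: "A \<in> \<F>" "A \<subseteq> {1..n}" "card A = r"
    and i: "i \<ge> 1" "c i \<in> A" "c (Suc i) \<in> A" "c i \<noteq> c (Suc i)"
  shows "\<not> acceptable (2 # replicate (r - 2) 1) \<F> c"
proof -
  have finA: "finite A" using A(2) finite_subset by blast
  define D where "D = A - {c i, c (Suc i)}"
  have cD: "card D = r - 2"
    unfolding D_def using i A finA by (simp add: card_Diff_subset)
  have "finite D" using finA by (simp add: D_def)
  then obtain f where f: "bij_betw f {0..<r - 2} D"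
    using ex_bij_betw_nat_finite cD by metis
  have img: "c ` {1..n} = {1..n}" using c by (auto simp: hamilton_cycle_def bij_betw_def)
  have "\<exists>j. j \<ge> 1 \<and> c j = f l" if "l < r - 2" for l
  proof -
    have "f l \<in> D" using f that by (auto simp: bij_betw_def)
    then have "f l \<in> c ` {1..n}" using A img by (auto simp: D_def)
    then show ?thesis by force
  qed
  then obtain g where g: "\<And>l. l < r - 2 \<Longrightarrow> g l \<ge> 1 \<and> c (g l) = f l" by metis
  \<comment> \<open>The interval of length \<open>2\<close> starts at \<open>i\<close>; the singletons run over the remaining elements.\<close>
  define t where "t k = (case k of 0 \<Rightarrow> i - 1 | Suc l \<Rightarrow> g l - 1)" for k
  have "(\<Union>k<length (2 # replicate (r - 2) (1::nat)).
      c ` {t k + 1..t k + (2 # replicate (r - 2) 1) ! k})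
    = c ` {t 0 + 1..t 0 + 2} \<union> (\<Union>l<r - 2. c ` {t (Suc l) + 1..t (Suc l) + 1})"
    unfolding length_Cons lessThan_Suc_eq_insert_0 by simp
  also have "c ` {t 0 + 1..t 0 + 2} = {c i, c (Suc i)}"
  proof -
    have "{t 0 + 1..t 0 + 2} = {i, Suc i}" using i(1) by (auto simp: t_def)
    then show ?thesis by simp
  qed
  also have "(\<Union>l<r - 2. c ` {t (Suc l) + 1..t (Suc l) + 1}) = (\<Union>l<r - 2. {f l})"
  proof (intro SUP_cong refl)
    fix l assume "l \<in> {..<r - 2}"
    then have "Suc (g l - 1) = g l" "c (g l) = f l" using g[of l] by auto
    then show "c ` {t (Suc l) + 1..t (Suc l) + 1} = {f l}" by (simp add: t_def)
  qed
  also have "\<dots> = D" using f by (auto simp: bij_betw_def)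
  also have "{c i, c (Suc i)} \<union> D = A" using i by (auto simp: D_def)
  finally have "(\<Union>k<length (2 # replicate (r - 2) (1::nat)).
      c ` {t k + 1..t k + (2 # replicate (r - 2) 1) ! k}) \<in> \<F>"
    using A(1) by (simp only:)
  then show ?thesis unfolding acceptable_def by blast
qed

lemma hamiltonian_imp_hamilton_cycle:
  assumes ham: "hamiltonian {1..n} E" and n: "n \<ge> 1"
  obtains c where "hamilton_cycle n c" "\<And>i. E (c i) (c (Suc i))"
proof -
  obtain xs where xs: "distinct xs" "set xs = {1..n}" "successively E xs" "E (last xs) (hd xs)"
    using ham by (auto simp: hamiltonian_def)
  have len: "length xs = n" using xs distinct_card by fastforce
  then have ne: "xs \<noteq> []" using n by auto
  define c where "c i = xs ! (i mod n)" for i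
  have "c ` {1..n} = set xs"
  proof
    have "i mod n < length xs" for i using n unfolding len by simp
    then show "c ` {1..n} \<subseteq> set xs" by (auto simp: c_def)
    show "set xs \<subseteq> c ` {1..n}"
    proof
      fix x assume "x \<in> set xs"
      then obtain j where j: "j < n" "x = xs ! j" using len by (auto simp: in_set_conv_nth)
      show "x \<in> c ` {1..n}"
      proof (cases "j = 0")
        case True
        then show ?thesis using j n by (intro image_eqI[of _ _ n]) (auto simp: c_def)
      next
        case False
        then show ?thesis using j by (intro image_eqI[of _ _ j]) (auto simp: c_def)
      qed
    qed
  qed
  then have "c ` {1..n} = {1..n}" using xs by simp
  moreover from this have "inj_on c {1..n}" by (intro eq_card_imp_inj_on) auto
  ultimately have "hamilton_cycle n c"
    by (auto simp: hamilton_cycle_def bij_betw_def c_def)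
  moreover have "E (c i) (c (Suc i))" for i
  proof (cases "Suc (i mod n) = n")
    case True
    then have "i mod n = length xs - 1" "Suc i mod n = 0" using len by (simp_all add: mod_Suc)
    then have "c i = last xs" "c (Suc i) = hd xs"
      using ne by (simp_all add: c_def last_conv_nth hd_conv_nth)
    then show ?thesis using xs by simp
  next
    case False
    then have lt: "Suc (i mod n) < n" using n by (simp add: Suc_lessI)
    then have "Suc i mod n = Suc (i mod n)" by (simp add: mod_Suc)
    then show ?thesis using xs(3) len lt by (auto simp: c_def successively_conv_nth)
  qed
  ultimately show thesis using that by blast
qed

section \<open>Lower bound\<close>

lemma ex_acceptable_cycle:
  assumes r: "r \<ge> 2" and n: "n \<ge> 8 * r"
    and F: "\<F> \<subseteq> subsets_of_size n r" and small: "(r - 1) * card \<F> + 4 * r + 1 < n"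
  shows "\<exists>c. hamilton_cycle n c \<and> acceptable (2 # x) \<F> c"
proof -
  define V where "V = {1..n}"
  define E where "E x y \<longleftrightarrow> x \<noteq> y \<and> \<not> (\<exists>A\<in>\<F>. x \<in> A \<and> y \<in> A)" for x y :: nat
  define d where "d x = card {A \<in> \<F>. x \<in> A}" for x
  define B where "B = {x \<in> V. 2 * degree V E x < n}"
  have V: "finite V" "card V = n" by (auto simp: V_def)
  have FA: "A \<subseteq> V" "card A = r" "finite A" if "A \<in> \<F>" for A
    using F that finite_subset[of A "{1..n}"] by (auto simp: subsets_of_size_def V_def)
  have finF: "finite \<F>"
    by (rule finite_subset[of _ "Pow V"]) (use FA V in auto)
  have deg: "n \<le> degree V E x + 1 + (r - 1) * d x" if "x \<in> V" for x
  proof -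
    let ?N = "\<Union>A\<in>{A \<in> \<F>. x \<in> A}. A - {x}"
    have "card ?N \<le> (\<Sum>A\<in>{A \<in> \<F>. x \<in> A}. card (A - {x}))"
      by (rule card_UN_le) (use finF in auto)
    also have "\<dots> = (\<Sum>A\<in>{A \<in> \<F>. x \<in> A}. r - 1)"
      using FA by (intro sum.cong) (auto simp: card_Diff_singleton)
    finally have cN: "card ?N \<le> (r - 1) * d x" by (simp add: d_def mult.commute)
    have finN: "finite ?N" using finF FA by auto
    have "V \<subseteq> {y \<in> V. E x y} \<union> ({x} \<union> ?N)" by (auto simp: E_def)
    then have "card V \<le> card ({y \<in> V. E x y} \<union> ({x} \<union> ?N))"
      using finN V(1) by (intro card_mono) auto
    also have "\<dots> \<le> card {y \<in> V. E x y} + (card {x} + card ?N)"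
      by (meson add_left_mono card_Un_le le_trans)
    finally show ?thesis using cN V by (simp add: degree_def)
  qed
  have dle: "d x \<le> card \<F>" for x
    unfolding d_def using finF by (intro card_mono) auto
  have deg_gt: "4 * r < degree V E x" if "x \<in> V" for x
    using deg[OF that] mult_le_mono2[OF dle[of x], of "r - 1"] small by linarith
  have finB: "finite B" "B \<subseteq> V" using V by (auto simp: B_def)
  \<comment> \<open>The bound on \<open>B\<close> comes from counting the pairs \<open>(x, A)\<close> with \<open>x \<in> A \<in> \<F>\<close> in two ways.\<close>
  have "(\<Sum>x\<in>B. d x) \<le> (\<Sum>x\<in>V. d x)"
    using finB V by (intro sum_mono2) auto
  also have "\<dots> = (\<Sum>x\<in>V. \<Sum>A\<in>\<F>. if x \<in> A then 1 else 0)"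
    unfolding d_def using finF by (intro sum.cong refl) (simp add: sum.If_cases Int_def)
  also have "\<dots> = (\<Sum>A\<in>\<F>. \<Sum>x\<in>V. if x \<in> A then 1 else 0)" by (rule sum.swap)
  also have "\<dots> = (\<Sum>A\<in>\<F>. r)"
  proof (intro sum.cong refl)
    fix A assume "A \<in> \<F>"
    then have "V \<inter> A = A" "card A = r" using FA by auto
    then show "(\<Sum>x\<in>V. if x \<in> A then 1 else 0) = r" using V by (simp add: sum.If_cases)
  qed
  finally have sumB: "(\<Sum>x\<in>B. d x) \<le> r * card \<F>" by (simp add: mult.commute)
  have "n * card B = (\<Sum>x\<in>B. n)" by simp
  also have "\<dots> \<le> (\<Sum>x\<in>B. 4 * (r - 1) * d x)"
  proof (rule sum_mono)
    fix x assume "x \<in> B"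
    then have "x \<in> V" "2 * degree V E x < n" by (auto simp: B_def)
    then show "n \<le> 4 * (r - 1) * d x"
      using deg[of x] n r by (simp add: algebra_simps)
  qed
  also have "\<dots> = 4 * (r - 1) * (\<Sum>x\<in>B. d x)" by (simp add: sum_distrib_left)
  also have "\<dots> \<le> 4 * (r - 1) * (r * card \<F>)" using sumB by (rule mult_le_mono2)
  also have "\<dots> = 4 * r * ((r - 1) * card \<F>)" by simp
  also have "\<dots> \<le> 4 * r * n" using small by (intro mult_le_mono2) linarith
  finally have "n * card B \<le> n * (4 * r)" by (simp add: mult.commute)
  then have cB: "card B \<le> 4 * r" using n r by simp
  have "hamiltonian V E"
  proof (rule hamiltonian_few_small_degrees[where B = B])
    show "card B < degree V E x" if "x \<in> B" for x
      using deg_gt[of x] cB that finB by fastforce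
  qed (use V finB cB n r in \<open>auto simp: E_def B_def\<close>)
  then obtain c where c: "hamilton_cycle n c" "\<And>i. E (c i) (c (Suc i))"
    using hamiltonian_imp_hamilton_cycle[of n E] n r by (auto simp: V_def)
  have "acceptable (2 # x) \<F> c"
    by (rule acceptable_if_no_consecutive) (use c(2) in \<open>auto simp: E_def\<close>)
  then show ?thesis using c by blast
qed

section \<open>Upper bound\<close>

text \<open>
  The family consists of the sets \<open>{n} \<union> I\<close>, where \<open>I\<close> runs over blocks of \<open>r - 1\<close> consecutive
  numbers covering \<open>{1..n - 1}\<close>; the last block is shifted to the left so as to end at \<open>n - 1\<close>.
\<close>

lemma ex_family_no_acceptable_cycle:
  assumes r: "r \<ge> 2" and n: "n \<ge> r"
  shows "\<exists>\<F>. \<F> \<subseteq> subsets_of_size n r \<and> card \<F> \<le> (n - 2) div (r - 1) + 1 \<and>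
    \<not> (\<exists>c. hamilton_cycle n c \<and> acceptable (2 # replicate (r - 2) 1) \<F> c)"
proof -
  define s where "s j = min (j * (r - 1)) (n - r)" for j
  define A where "A j = insert n {s j + 1..s j + (r - 1)}" for j
  let ?q = "(n - 2) div (r - 1)"
  have sle: "s j + (r - 1) \<le> n - 1" for j using n r by (simp add: s_def)
  have Asub: "A j \<subseteq> {1..n}" "card (A j) = r" for j
  proof -
    show "A j \<subseteq> {1..n}" using sle[of j] r n by (auto simp: A_def)
    have "n \<notin> {s j + 1..s j + (r - 1)}" using sle[of j] r n by auto
    then show "card (A j) = r" using r by (simp add: A_def)
  qed
  have cover: "\<exists>j\<le>?q. w \<in> A j" if w: "1 \<le> w" "w < n" for w
  proof (intro exI conjI)
    let ?j = "(w - 1) div (r - 1)"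
    show "?j \<le> ?q" using w by (intro div_le_mono) simp
    define k where "k = ?j * (r - 1)"
    have "k \<le> w - 1" by (simp add: k_def)
    moreover have "w - 1 < k + (r - 1)"
      unfolding k_def
      using r dividend_less_times_div[of "r - 1" "w - 1"] by (simp add: mult.commute add.commute)
    ultimately show "w \<in> A ?j" 
      using w n r unfolding A_def s_def k_def[symmetric] by (auto simp: min_def)
  qed
  have "\<not> acceptable (2 # replicate (r - 2) 1) (A ` {..?q}) c" if c: "hamilton_cycle n c" for c
  proof -
    have bij: "inj_on c {1..n}" "c ` {1..n} = {1..n}" and per: "c (i + n) = c i" for i
      using c by (auto simp: hamilton_cycle_def bij_betw_def)
    have "n \<in> c ` {1..n}" using bij r n by simp
    then obtain i where i: "1 \<le> i" "i \<le> n" "c i = n" by force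
    have "c (Suc i) \<in> {1..n} \<and> c (Suc i) \<noteq> n"
    proof (cases "i = n")
      case True
      have "c (Suc i) = c 1" using per[of 1] True by simp
      moreover have "c 1 \<noteq> c n" using bij(1) r n by (auto dest!: inj_onD[of c _ 1 n])
      moreover have "c 1 \<in> {1..n}" using bij(2) r n by auto
      ultimately show ?thesis using True i by simp
    next
      case False
      then have "c (Suc i) \<noteq> c i" using bij(1) i by (auto dest!: inj_onD[of c _ "Suc i" i])
      moreover have "c (Suc i) \<in> {1..n}" using bij(2) i False by auto
      ultimately show ?thesis using i by simp
    qed
    then have w: "1 \<le> c (Suc i)" "c (Suc i) < n" by auto
    then obtain j where j: "j \<le> ?q" "c (Suc i) \<in> A j" using cover by blast
    show ?thesis
    proof (rule not_acceptable_if_consecutive[OF c, of "A j"])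
      show "A j \<in> A ` {..?q}" using j by simp
      show "c i \<in> A j" using i by (simp add: A_def)
    qed (use Asub i j w in auto)
  qed
  moreover have "A ` {..?q} \<subseteq> subsets_of_size n r"
    using Asub by (auto simp: subsets_of_size_def)
  moreover have "card (A ` {..?q}) \<le> ?q + 1"
    using card_image_le[of "{..?q}" A] by simp
  ultimately show ?thesis by blast
qed

section \<open>The asymptotics\<close>

lemma sum_list_two_ones: "r \<ge> 2 \<Longrightarrow> sum_list (2 # replicate (r - 2) 1) = (r::nat)"
  by (simp add: sum_list_replicate)

lemma min_family_size_attained:
  assumes "r \<ge> 2" "n \<ge> r"
  shows "\<exists>\<F>. \<F> \<subseteq> subsets_of_size n r \<and>
    card \<F> = min_family_size (2 # replicate (r - 2) 1) n \<and>
    \<not> (\<exists>c. hamilton_cycle n c \<and> acceptable (2 # replicate (r - 2) 1) \<F> c)"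
proof -
  have "\<exists>s \<F>. \<F> \<subseteq> subsets_of_size n r \<and> card \<F> = s \<and>
      \<not> (\<exists>c. hamilton_cycle n c \<and> acceptable (2 # replicate (r - 2) 1) \<F> c)"
    using ex_family_no_acceptable_cycle[OF assms] by blast
  from LeastI_ex[OF this] show ?thesis
    unfolding min_family_size_def sum_list_two_ones[OF assms(1)] .
qed

lemma min_family_size_upper:
  assumes "r \<ge> 2" "n \<ge> r"
  shows "min_family_size (2 # replicate (r - 2) 1) n \<le> (n - 2) div (r - 1) + 1"
proof -
  obtain \<F> where F: "\<F> \<subseteq> subsets_of_size n r" "card \<F> \<le> (n - 2) div (r - 1) + 1"
    "\<not> (\<exists>c. hamilton_cycle n c \<and> acceptable (2 # replicate (r - 2) 1) \<F> c)"
    using ex_family_no_acceptable_cycle[OF assms] by blast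
  have "min_family_size (2 # replicate (r - 2) 1) n \<le> card \<F>"
    unfolding min_family_size_def sum_list_two_ones[OF assms(1)]
    by (rule Least_le) (use F in blast)
  then show ?thesis using F by linarith
qed

lemma min_family_size_lower:
  assumes "r \<ge> 2" "n \<ge> 8 * r"
  shows "n \<le> (r - 1) * min_family_size (2 # replicate (r - 2) 1) n + 4 * r + 1"
proof (rule ccontr)
  assume "\<not> ?thesis"
  then have less: "(r - 1) * min_family_size (2 # replicate (r - 2) 1) n + 4 * r + 1 < n" by simp
  have "n \<ge> r" using assms by simp
  from min_family_size_attained[OF assms(1) this]
  obtain \<F> where F: "\<F> \<subseteq> subsets_of_size n r"
    "card \<F> = min_family_size (2 # replicate (r - 2) 1) n"
    "\<not> (\<exists>c. hamilton_cycle n c \<and> acceptable (2 # replicate (r - 2) 1) \<F> c)" by blast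
  have "(r - 1) * card \<F> + 4 * r + 1 < n" using less unfolding F(2) .
  from ex_acceptable_cycle[OF assms F(1) this] F(3) show False by blast
qed

theorem theorem20:
  fixes r :: nat
  assumes "r \<ge> 2"
  shows "\<exists>\<epsilon> :: nat \<Rightarrow> real. \<epsilon> \<longlonglongrightarrow> 0 \<and>
    (\<forall>n\<ge>r. real (min_family_size (2 # replicate (r - 2) 1) n) = (1 / (real r - 1) + \<epsilon> n) * real n)"
proof -
  define m where "m n = min_family_size (2 # replicate (r - 2) 1) n" for n
  define \<epsilon> where "\<epsilon> n = real (m n) / real n - 1 / (real r - 1)" for n
  define k where "k = real r - 1"
  have k1: "k \<ge> 1" and kr: "real (r - 1) = k" using assms by (auto simp: k_def of_nat_diff)
  have bound: "\<bar>\<epsilon> n\<bar> \<le> (4 * real r + 1) / real n" if n: "n \<ge> 8 * r" for n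
  proof -
    have n0: "real n > 0" using n assms by simp
    have "m n \<le> (n - 2) div (r - 1) + 1"
      using min_family_size_upper[of r n] assms n by (simp add: m_def)
    then have "m n * (r - 1) \<le> (n - 2) div (r - 1) * (r - 1) + (r - 1)"
      using mult_le_mono1[of "m n" "(n - 2) div (r - 1) + 1" "r - 1"]
      by (simp only: add_mult_distrib mult_1)
    also have "\<dots> \<le> n + (r - 1)"
      by (intro add_right_mono) (rule order_trans[OF div_times_less_eq_dividend], simp)
    finally have "real (m n * (r - 1)) \<le> real (n + (r - 1))" by (simp only: of_nat_le_iff)
    then have up: "real (m n) * k - real n \<le> k"
      unfolding of_nat_mult of_nat_add kr by simp
    have "n \<le> (r - 1) * m n + 4 * r + 1"
      using min_family_size_lower[of r n] assms n by (simp add: m_def)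
    then have "real n \<le> real ((r - 1) * m n + 4 * r + 1)" by (simp only: of_nat_le_iff)
    then have lo: "real n \<le> k * real (m n) + 4 * real r + 1"
      unfolding of_nat_mult of_nat_add kr by simp
    have "\<epsilon> n = real (m n) / real n - 1 / k" by (simp add: \<epsilon>_def k_def)
    also have "\<dots> = (real (m n) * k - real n) / k / real n"
      using n0 k1 by (simp add: field_simps)
    finally have "\<bar>\<epsilon> n\<bar> = \<bar>real (m n) * k - real n\<bar> / k / real n"
      using n0 k1 by simp
    also have "\<dots> \<le> (4 * real r + 1) / real n"
    proof (rule divide_right_mono)
      have "\<bar>real (m n) * k - real n\<bar> \<le> 4 * real r + 1"
      proof (rule abs_leI)
        show "real (m n) * k - real n \<le> 4 * real r + 1" using up k_def by linarith
        show "- (real (m n) * k - real n) \<le> 4 * real r + 1"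
          using lo mult.commute[of k "real (m n)"] by linarith
      qed
      also have "\<dots> \<le> (4 * real r + 1) * k"
        using mult_left_mono[OF k1, of "4 * real r + 1"] by simp
      finally show "\<bar>real (m n) * k - real n\<bar> / k \<le> 4 * real r + 1"
        using k1 by (simp add: pos_divide_le_eq)
    qed simp
    finally show ?thesis .
  qed
  have "\<epsilon> \<longlonglongrightarrow> 0"
  proof (rule tendsto_0_le[where K = 1])
    show "\<forall>\<^sub>F n in sequentially. norm (\<epsilon> n) \<le> norm ((4 * real r + 1) / real n) * 1"
      using bound by (intro eventually_sequentiallyI[of "8 * r"]) simp
    show "(\<lambda>n. (4 * real r + 1) / real n) \<longlonglongrightarrow> 0"
      by (rule lim_const_over_n)
  qed
  moreover have "real (m n) = (1 / (real r - 1) + \<epsilon> n) * real n" if "n \<ge> r" for n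
    using that assms by (simp add: \<epsilon>_def)
  ultimately show ?thesis unfolding m_def by blast
qed

end
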